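(* Let $(\pi,\mathbf x)$ be a priority-feasible allocation, i.e. $\pi=(\pi_1,\dots,\pi_n)$ is an ordering of the positions, $\mathbf x=(x_1,\dots,x_n)$ are sale quantities, and for every $j$ $$K_{\pi_j}+\underline B^{\pi_j\mid\pi_{<j}}_{u,\Delta}(x_{\pi_j})\ \ge\ \overline H_{\pi_j}+m_{\pi_j}.$$ Suppose the realized path $\omega$ lies in $\mathcal U^{\mathrm{op}}_{u,\mathrm{agg}}(\Delta)$; the actual market close satisfies $T_c^{\mathrm{act}}(\omega)>u+\Delta$; execution authority, collateral non-escape with loan priority, and settlement observability and finality hold throughout $[u,u+\Delta]$; the policy executes the sales in order $\pi$, each position's confirmed proceeds being applied debt-first to its own loan, with all used fills settling by $u+\Delta$; and no new borrowing is created after $u$. Then the allocation clears every loan in order $\pi$ without assigning the same unit of shared-book proceeds to more than one position.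
   Context: Consider $n$ leveraged positions in the same token sharing one execution book in a window starting at decision time $u$ with horizon $\Delta$; each loan must be repaid only from its own sold tokens and its own cash. Position $i$ has token quantity $q_i\ge x_i\ge 0$, dedicated confirmed cash $K_i\ge0$, buffer $m_i\ge0$, and $\overline H_i$ is an upper bound over the aggregate operating set on its debt-service requirement (cash applied to its loan after $u$ plus debt outstanding at $u+\Delta$). $\mathcal U^{\mathrm{op}}_{u,\mathrm{agg}}(\Delta)\subseteq\Omega$ is the registered aggregate operating set of paths. $\mathcal B^{\mathrm{set},\Pi}_{u,\Delta}(X,\omega)$ is the settled net proceeds, confirmed by $u+\Delta$ on path $\omega$, from executing aggregate quantity $X$ through the shared book under policy $\Pi$ (zero at $X=0$). With $X_{j-1}=\sum_{k<j}x_{\pi_k}$, on path $\omega$ position $\pi_j$ is assigned the proceeds increment $\mathcal B^{\mathrm{set},\Pi}_{u,\Delta}(X_{j-1}+x_{\pi_j},\omega)-\mathcal B^{\mathrm{set},\Pi}_{u,\Delta}(X_{j-1},\omega)$, and the certified incremental lower proceeds are $$\underline B^{\pi_j\mid\pi_{<j}}_{u,\Delta}(x_{\pi_j})=\inf_{\omega\in\mathcal U^{\mathrm{op}}_{u,\mathrm{agg}}(\Delta)}\Big[\mathcal B^{\mathrm{set},\Pi}_{u,\Delta}(X_{j-1}+x_{\pi_j},\omega)-\mathcal B^{\mathrm{set},\Pi}_{u,\Delta}(X_{j-1},\omega)\Big].$$ "Without assigning the same unit of proceeds to more than one position" means that the assigned increments together account for each unit of the realized aggregate proceeds $\mathcal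 B^{\mathrm{set},\Pi}_{u,\Delta}(\sum_jx_{\pi_j},\omega)$ at most once. Named conditions. Debt-first: a confirmed increment $\Delta b$ arriving when the loan's debt is $D$ and cash is $K$ triggers payment $\min\{D,K+\Delta b\}$. Execution authority: while debt is positive the controller can submit, replace, cancel and settle risk-reducing orders without new borrower consent. Collateral non-escape and loan priority: while debt is positive the borrower cannot remove the financed tokens or dedicated cash, and settled proceeds go to the loan first. Settlement observability and finality: finalized fills are identifiable, and only confirmed, non-reversible receipts reduce debt. $T_c^{\mathrm{act}}$ is the first time at which risk-reducing orders are no longer accepted. *)

theory Defs
  imports Complex_Main "HOL-Library.Extended_Real"
begin

text \<open>
  Paths are the elements of the type \<open>'w\<close>, fills the elements of the type \<open>'f\<close>, positions the
  numbers \<open>0, \<dots>, n - 1\<close>. The policy is fixed once and for all: the path-dependent fields describe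
  what happens on a path when that policy is run. Debt and cash are given by ledger postings at
  finitely many instants of the half-open window \<open>(u, u + \<Delta>]\<close>, except for interest and
  charges, which may accrue at arbitrary times. At one instant the postings take effect in the
  order: accrual, receipt, payment to the loan, drawing and removal.
\<close>

datatype order_action = Submit | Replace | Cancel | Settle

datatype asset = Financed_Tokens | Dedicated_Cash

record ('w, 'f) shared_book =
  num_pos :: nat
  dec_time :: real                          \<comment> \<open>decision time \<open>u\<close>\<close>
  horizon :: real                           \<comment> \<open>\<open>\<Delta>\<close>\<close>
  op_set :: "'w set"                        \<comment> \<open>registered aggregate operating set\<close>
  book :: "real \<Rightarrow> 'w \<Rightarrow> real"              \<comment> \<open>settled net proceeds, by aggregate quantity and path\<close>
  accepts_orders :: "real \<Rightarrow> 'w \<Rightarrow> bool"   \<comment> \<open>risk-reducing orders are accepted at this time\<close>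
  token_qty :: "nat \<Rightarrow> real"                \<comment> \<open>\<open>q\<close>\<close>
  own_cash :: "nat \<Rightarrow> real"                 \<comment> \<open>\<open>K\<close>, confirmed cash at \<open>u\<close>\<close>
  buffer :: "nat \<Rightarrow> real"                   \<comment> \<open>\<open>m\<close>\<close>
  service_bound :: "nat \<Rightarrow> real"            \<comment> \<open>upper bound on the debt-service requirement\<close>
  debt_at_dec :: "nat \<Rightarrow> real"              \<comment> \<open>debt outstanding at \<open>u\<close>\<close>
  ledger_times :: "nat \<Rightarrow> 'w \<Rightarrow> real set"
  settle_times :: "nat \<Rightarrow> 'w \<Rightarrow> real set"   \<comment> \<open>instants at which the debt-first rule is run\<close>
  accrued :: "nat \<Rightarrow> real \<Rightarrow> 'w \<Rightarrow> real"    \<comment> \<open>cumulative interest and charges since \<open>u\<close>\<close>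
  drawn :: "nat \<Rightarrow> real \<Rightarrow> 'w \<Rightarrow> real"      \<comment> \<open>new borrowing at this instant\<close>
  paid :: "nat \<Rightarrow> real \<Rightarrow> 'w \<Rightarrow> real"       \<comment> \<open>cash applied to the loan at this instant\<close>
  removed :: "asset \<Rightarrow> nat \<Rightarrow> real \<Rightarrow> 'w \<Rightarrow> real"  \<comment> \<open>taken out by the borrower at this instant\<close>
  can_remove :: "asset \<Rightarrow> nat \<Rightarrow> real \<Rightarrow> 'w \<Rightarrow> bool"
  can_act :: "order_action \<Rightarrow> nat \<Rightarrow> real \<Rightarrow> 'w \<Rightarrow> bool"
    \<comment> \<open>the controller can perform this action on risk-reducing orders without new borrower consent\<close>
  fills :: "'w \<Rightarrow> 'f set"                   \<comment> \<open>fills used by the allocation\<close>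
  fill_owner :: "'f \<Rightarrow> 'w \<Rightarrow> nat"
  fill_qty :: "'f \<Rightarrow> 'w \<Rightarrow> real"
  fill_net :: "'f \<Rightarrow> 'w \<Rightarrow> real"            \<comment> \<open>net proceeds\<close>
  exec_time :: "'f \<Rightarrow> 'w \<Rightarrow> real"
  confirm_time :: "'f \<Rightarrow> 'w \<Rightarrow> real"        \<comment> \<open>the proceeds are credited at this instant\<close>
  finalized :: "'f \<Rightarrow> real \<Rightarrow> 'w \<Rightarrow> bool"   \<comment> \<open>confirmed and non-reversible at this time\<close>
  identifiable :: "'f \<Rightarrow> real \<Rightarrow> 'w \<Rightarrow> bool"

definition end_time :: "('w, 'f) shared_book \<Rightarrow> real" where
  "end_time M = dec_time M + horizon M"

definition owned_fills :: "('w, 'f) shared_book \<Rightarrow> nat \<Rightarrow> 'w \<Rightarrow> 'f set" where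
  "owned_fills M i \<omega> = {f \<in> fills M \<omega>. fill_owner M f \<omega> = i}"

text \<open>The confirmed increment of position \<open>i\<close> at time \<open>t\<close>.\<close>

definition receipt :: "('w, 'f) shared_book \<Rightarrow> nat \<Rightarrow> real \<Rightarrow> 'w \<Rightarrow> real" where
  "receipt M i t \<omega> = (\<Sum>f \<in> {f \<in> owned_fills M i \<omega>. confirm_time M f \<omega> = t}. fill_net M f \<omega>)"

text \<open>Debt and cash immediately before the receipt and the payment at time \<open>t\<close>, and the debt
  once everything at time \<open>t\<close> has been posted.\<close>

definition debt_before :: "('w, 'f) shared_book \<Rightarrow> nat \<Rightarrow> real \<Rightarrow> 'w \<Rightarrow> real" where
  "debt_before M i t \<omega> = debt_at_dec M i + accrued M i t \<omega>
     + (\<Sum>s \<in> {s \<in> ledger_times M i \<omega>. s < t}. drawn M i s \<omega> - paid M i s \<omega>)"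

definition cash_before :: "('w, 'f) shared_book \<Rightarrow> nat \<Rightarrow> real \<Rightarrow> 'w \<Rightarrow> real" where
  "cash_before M i t \<omega> = own_cash M i
     + (\<Sum>s \<in> {s \<in> ledger_times M i \<omega>. s < t}.
          receipt M i s \<omega> - paid M i s \<omega> - removed M Dedicated_Cash i s \<omega>)"

definition debt :: "('w, 'f) shared_book \<Rightarrow> nat \<Rightarrow> real \<Rightarrow> 'w \<Rightarrow> real" where
  "debt M i t \<omega> = debt_at_dec M i + accrued M i t \<omega>
     + (\<Sum>s \<in> {s \<in> ledger_times M i \<omega>. s \<le> t}. drawn M i s \<omega> - paid M i s \<omega>)"

definition total_paid :: "('w, 'f) shared_book \<Rightarrow> nat \<Rightarrow> 'w \<Rightarrow> real" where
  "total_paid M i \<omega> = (\<Sum>s \<in> ledger_times M i \<omega>. paid M i s \<omega>)"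

definition service_requirement :: "('w, 'f) shared_book \<Rightarrow> nat \<Rightarrow> 'w \<Rightarrow> real" where
  "service_requirement M i \<omega> = total_paid M i \<omega> + debt M i (end_time M) \<omega>"

text \<open>Bookkeeping consistency of the data. In particular debt is never negative, payments,
  drawings and removals are recorded as non-negative amounts, and interest and charges accrue only
  on outstanding debt: a loan that is fully repaid and not redrawn stays at zero.\<close>

definition book_wf :: "('w, 'f) shared_book \<Rightarrow> bool" where
  "book_wf M \<longleftrightarrow>
     0 < horizon M \<and>
     (\<forall>\<omega>. book M 0 \<omega> = 0) \<and>
     (\<forall>i < num_pos M. 0 \<le> token_qty M i \<and> 0 \<le> own_cash M i \<and> 0 \<le> buffer M i \<and> 0 \<le> debt_at_dec M i) \<and>
     (\<forall>\<omega>. finite (fills M \<omega>) \<and> (\<forall>f \<in> fills M \<omega>. fill_owner M f \<omega> < num_pos M)) \<and>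
     (\<forall>i < num_pos M. \<forall>\<omega>.
        finite (ledger_times M i \<omega>) \<and>
        ledger_times M i \<omega> \<subseteq> {dec_time M <.. end_time M} \<and>
        settle_times M i \<omega> \<subseteq> ledger_times M i \<omega> \<and>
        (\<forall>t. 0 \<le> paid M i t \<omega> \<and> 0 \<le> drawn M i t \<omega>) \<and>
        (\<forall>t. t \<notin> ledger_times M i \<omega> \<longrightarrow> paid M i t \<omega> = 0 \<and> drawn M i t \<omega> = 0) \<and>
        (\<forall>a t. 0 \<le> removed M a i t \<omega> \<and>
               (t \<notin> ledger_times M i \<omega> \<longrightarrow> removed M a i t \<omega> = 0) \<and>
               (removed M a i t \<omega> \<noteq> 0 \<longrightarrow> can_remove M a i t \<omega>)) \<and>
        accrued M i (dec_time M) \<omega> = 0 \<and>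
        mono_on {dec_time M .. end_time M} (\<lambda>t. accrued M i t \<omega>) \<and>
        (\<forall>t \<in> {dec_time M .. end_time M}. 0 \<le> debt M i t \<omega>) \<and>
        (\<forall>s t. dec_time M \<le> s \<and> s \<le> t \<and> t \<le> end_time M \<and> debt M i s \<omega> = 0 \<and>
               (\<forall>r \<in> {s <.. t}. drawn M i r \<omega> = 0)
               \<longrightarrow> accrued M i t \<omega> = accrued M i s \<omega>))"

definition service_bound_valid :: "('w, 'f) shared_book \<Rightarrow> bool" where
  "service_bound_valid M \<longleftrightarrow>
     (\<forall>i < num_pos M. \<forall>\<omega> \<in> op_set M. service_requirement M i \<omega> \<le> service_bound M i)"


subsection \<open>Priority-feasible allocations\<close>

text \<open>The ordering \<open>\<pi>\<close> maps ranks \<open>0, \<dots>, n - 1\<close> to positions; \<open>x\<close> is indexed by positions.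
  \<open>cum_qty \<pi> x j\<close> is the quantity sold for the first \<open>j\<close> positions.\<close>

definition cum_qty :: "(nat \<Rightarrow> nat) \<Rightarrow> (nat \<Rightarrow> real) \<Rightarrow> nat \<Rightarrow> real" where
  "cum_qty \<pi> x j = (\<Sum>k<j. x (\<pi> k))"

definition increment ::
  "('w, 'f) shared_book \<Rightarrow> (nat \<Rightarrow> nat) \<Rightarrow> (nat \<Rightarrow> real) \<Rightarrow> nat \<Rightarrow> 'w \<Rightarrow> real" where
  "increment M \<pi> x j \<omega> = book M (cum_qty \<pi> x j + x (\<pi> j)) \<omega> - book M (cum_qty \<pi> x j) \<omega>"

text \<open>The infimum is taken in the extended reals: it is \<open>-\<infinity>\<close> if the increments are unbounded
  below on the operating set.\<close>

definition lower_proceeds ::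
  "('w, 'f) shared_book \<Rightarrow> (nat \<Rightarrow> nat) \<Rightarrow> (nat \<Rightarrow> real) \<Rightarrow> nat \<Rightarrow> ereal" where
  "lower_proceeds M \<pi> x j = (INF \<omega> \<in> op_set M. ereal (increment M \<pi> x j \<omega>))"

definition priority_feasible ::
  "('w, 'f) shared_book \<Rightarrow> (nat \<Rightarrow> nat) \<Rightarrow> (nat \<Rightarrow> real) \<Rightarrow> bool" where
  "priority_feasible M \<pi> x \<longleftrightarrow>
     bij_betw \<pi> {..<num_pos M} {..<num_pos M} \<and>
     (\<forall>i < num_pos M. 0 \<le> x i \<and> x i \<le> token_qty M i) \<and>
     (\<forall>j < num_pos M. ereal (own_cash M (\<pi> j)) + lower_proceeds M \<pi> x j
                        \<ge> ereal (service_bound M (\<pi> j) + buffer M (\<pi> j)))"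


subsection \<open>Named conditions, on a path\<close>

definition market_close :: "('w, 'f) shared_book \<Rightarrow> 'w \<Rightarrow> ereal" where
  "market_close M \<omega> = Inf (ereal ` {t. dec_time M \<le> t \<and> \<not> accepts_orders M t \<omega>})"

definition execution_authority :: "('w, 'f) shared_book \<Rightarrow> 'w \<Rightarrow> bool" where
  "execution_authority M \<omega> \<longleftrightarrow>
     (\<forall>i < num_pos M. \<forall>t \<in> {dec_time M .. end_time M}.
        0 < debt M i t \<omega> \<longrightarrow> (\<forall>a. can_act M a i t \<omega>))"

definition collateral_non_escape :: "('w, 'f) shared_book \<Rightarrow> 'w \<Rightarrow> bool" where
  "collateral_non_escape M \<omega> \<longleftrightarrow>
     (\<forall>i < num_pos M. \<forall>t \<in> {dec_time M .. end_time M}.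
        0 < debt M i t \<omega> \<longrightarrow> (\<forall>a. \<not> can_remove M a i t \<omega>))"

text \<open>While there is debt, a receipt goes to the loan up to the amount owed.\<close>

definition loan_priority :: "('w, 'f) shared_book \<Rightarrow> 'w \<Rightarrow> bool" where
  "loan_priority M \<omega> \<longleftrightarrow>
     (\<forall>i < num_pos M. \<forall>t \<in> {dec_time M .. end_time M}.
        0 < debt_before M i t \<omega> \<longrightarrow> min (debt_before M i t \<omega>) (receipt M i t \<omega>) \<le> paid M i t \<omega>)"

text \<open>The last clause says that debt is reduced only when the debt-first rule is run, and only out
  of confirmed cash of the position; by the second clause the receipts making up that cash are
  final.\<close>

definition settlement_finality :: "('w, 'f) shared_book \<Rightarrow> 'w \<Rightarrow> bool" where
  "settlement_finality M \<omega> \<longleftrightarrow>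
     (\<forall>f \<in> fills M \<omega>. \<forall>t \<in> {dec_time M .. end_time M}. finalized M f t \<omega> \<longrightarrow>
        identifiable M f t \<omega> \<and> (\<forall>s \<in> {t .. end_time M}. finalized M f s \<omega>)) \<and>
     (\<forall>f \<in> fills M \<omega>. confirm_time M f \<omega> \<in> {dec_time M .. end_time M} \<longrightarrow>
        finalized M f (confirm_time M f \<omega>) \<omega>) \<and>
     (\<forall>i < num_pos M. \<forall>t \<in> {dec_time M .. end_time M}. 0 < paid M i t \<omega> \<longrightarrow>
        t \<in> settle_times M i \<omega> \<and> paid M i t \<omega> \<le> cash_before M i t \<omega> + receipt M i t \<omega>)"

text \<open>The last clause says what the book function measures: the first \<open>j\<close> sales together put
  the aggregate quantity \<open>cum_qty \<pi> x j\<close> through the shared book.\<close>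

definition executes_in_order ::
  "('w, 'f) shared_book \<Rightarrow> (nat \<Rightarrow> nat) \<Rightarrow> (nat \<Rightarrow> real) \<Rightarrow> 'w \<Rightarrow> bool" where
  "executes_in_order M \<pi> x \<omega> \<longleftrightarrow>
     (\<forall>f \<in> fills M \<omega>. 0 \<le> fill_qty M f \<omega> \<and> dec_time M \<le> exec_time M f \<omega> \<and>
        exec_time M f \<omega> \<le> confirm_time M f \<omega>) \<and>
     (\<forall>j < num_pos M. \<forall>k < num_pos M. j < k \<longrightarrow>
        (\<forall>f \<in> owned_fills M (\<pi> j) \<omega>. \<forall>g \<in> owned_fills M (\<pi> k) \<omega>.
           exec_time M f \<omega> \<le> exec_time M g \<omega>)) \<and>
     (\<forall>j < num_pos M. (\<Sum>f \<in> owned_fills M (\<pi> j) \<omega>. fill_qty M f \<omega>) = x (\<pi> j)) \<and>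
     (\<forall>j \<le> num_pos M. (\<Sum>k<j. \<Sum>f \<in> owned_fills M (\<pi> k) \<omega>. fill_net M f \<omega>)
                          = book M (cum_qty \<pi> x j) \<omega>)"

definition fills_settle_in_window :: "('w, 'f) shared_book \<Rightarrow> 'w \<Rightarrow> bool" where
  "fills_settle_in_window M \<omega> \<longleftrightarrow>
     (\<forall>f \<in> fills M \<omega>. confirm_time M f \<omega> \<in> {dec_time M <.. end_time M})"

text \<open>The rule is run at every confirmation, and at least once for every position: a position
  whose sale produces no fill has confirmed increment \<open>0\<close>, and its own cash is then what is
  applied to the loan.\<close>

definition debt_first :: "('w, 'f) shared_book \<Rightarrow> 'w \<Rightarrow> bool" where
  "debt_first M \<omega> \<longleftrightarrow>
     (\<forall>i < num_pos M.
        settle_times M i \<omega> \<noteq> {} \<and>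
        (\<forall>f \<in> owned_fills M i \<omega>. confirm_time M f \<omega> \<in> settle_times M i \<omega>) \<and>
        (\<forall>t \<in> settle_times M i \<omega>.
           paid M i t \<omega> = min (debt_before M i t \<omega>) (cash_before M i t \<omega> + receipt M i t \<omega>)))"

definition no_new_borrowing :: "('w, 'f) shared_book \<Rightarrow> 'w \<Rightarrow> bool" where
  "no_new_borrowing M \<omega> \<longleftrightarrow>
     (\<forall>i < num_pos M. \<forall>t \<in> {dec_time M <.. end_time M}. drawn M i t \<omega> = 0)"


subsection \<open>Conclusions, on a path\<close>

text \<open>\<open>stage_end M \<pi> j \<omega>\<close> is the time at which the sales of rank \<open>0, \<dots>, j\<close> have settled.
  Clearing in order means: each loan is cleared, for the rest of the window, out of the own cash
  of the position and the increment assigned to it, as soon as its own sale has settled; hence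
  after stage \<open>j\<close> the first \<open>j + 1\<close> loans are cleared.\<close>

definition stage_end :: "('w, 'f) shared_book \<Rightarrow> (nat \<Rightarrow> nat) \<Rightarrow> nat \<Rightarrow> 'w \<Rightarrow> real" where
  "stage_end M \<pi> j \<omega> = Max (\<Union>k\<le>j. settle_times M (\<pi> k) \<omega>)"

definition clears_in_order ::
  "('w, 'f) shared_book \<Rightarrow> (nat \<Rightarrow> nat) \<Rightarrow> (nat \<Rightarrow> real) \<Rightarrow> 'w \<Rightarrow> bool" where
  "clears_in_order M \<pi> x \<omega> \<longleftrightarrow>
     (\<forall>j < num_pos M.
        debt M (\<pi> j) (end_time M) \<omega> = 0 \<and>
        (\<forall>t \<in> {Max (settle_times M (\<pi> j) \<omega>) .. end_time M}. debt M (\<pi> j) t \<omega> = 0) \<and>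
        stage_end M \<pi> j \<omega> \<le> end_time M \<and>
        (\<forall>k \<le> j. \<forall>t \<in> {stage_end M \<pi> j \<omega> .. end_time M}. debt M (\<pi> k) t \<omega> = 0) \<and>
        total_paid M (\<pi> j) \<omega> \<le> own_cash M (\<pi> j) + increment M \<pi> x j \<omega>)"

text \<open>Units of proceeds are the levels \<open>y\<close> of cumulative proceeds. Moving the cumulative proceeds
  from \<open>a\<close> to \<open>b\<close> assigns the units in \<open>{a<..b}\<close>, or takes back those in \<open>{b<..a}\<close> if \<open>b < a\<close>,
  which can happen because net proceeds need not be monotone in the quantity.\<close>

definition unit_count :: "real \<Rightarrow> real \<Rightarrow> real \<Rightarrow> int" where
  "unit_count a b y = of_bool (y \<in> {a<..b}) - of_bool (y \<in> {b<..a})"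

text \<open>The increments add up to the realized aggregate proceeds, and they do so unit by unit. If
  no increment is negative, different positions are assigned disjoint sets of units.\<close>

definition no_double_assignment ::
  "('w, 'f) shared_book \<Rightarrow> (nat \<Rightarrow> nat) \<Rightarrow> (nat \<Rightarrow> real) \<Rightarrow> 'w \<Rightarrow> bool" where
  "no_double_assignment M \<pi> x \<omega> \<longleftrightarrow>
     (let n = num_pos M;
          total = book M (\<Sum>j<n. x (\<pi> j)) \<omega>;
          lo = (\<lambda>j. book M (cum_qty \<pi> x j) \<omega>);
          hi = (\<lambda>j. book M (cum_qty \<pi> x j + x (\<pi> j)) \<omega>)
      in (\<forall>j<n. (\<Sum>f \<in> owned_fills M (\<pi> j) \<omega>. fill_net M f \<omega>) = increment M \<pi> x j \<omega>) \<and>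
         (\<Sum>j<n. increment M \<pi> x j \<omega>) = total \<and>
         (\<forall>y. (\<Sum>j<n. unit_count (lo j) (hi j) y) = unit_count 0 total y) \<and>
         ((\<forall>j<n. 0 \<le> increment M \<pi> x j \<omega>) \<longrightarrow>
            (\<forall>j<n. \<forall>k<n. j \<noteq> k \<longrightarrow> {lo j<..hi j} \<inter> {lo k<..hi k} = {})))"

end

theory Submission
  imports Defs
begin

text \<open>
  Payments happen only at settlement times, so the last settlement of a position is decisive. If
  its debt survived that instant, the debt-first rule would have spent all available cash there;
  nothing could have been removed earlier, since debt was positive throughout, and total payments
  would be the own cash plus the increment. Feasibility puts this above the service bound, hence
  above total payments plus terminal debt, so the terminal debt is zero; without later payments
  debt cannot have been larger before. Assigned increments telescope, both as amounts and as
  signed indicators of units.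
\<close>

section \<open>Telescoping of assigned proceeds and of their units\<close>

lemma unit_count_eq: "unit_count a b y = of_bool (y \<le> b) - of_bool (y \<le> a)"
  by (auto simp: unit_count_def)

lemma cum_qty_Suc: "cum_qty \<pi> x (Suc j) = cum_qty \<pi> x j + x (\<pi> j)"
  by (simp add: cum_qty_def)

lemma increment_eq_diff:
  "increment M \<pi> x j \<omega> = book M (cum_qty \<pi> x (Suc j)) \<omega> - book M (cum_qty \<pi> x j) \<omega>"
  by (simp add: increment_def cum_qty_Suc)

text \<open>Execution fixes only the net proceeds of the first \<open>j\<close> sales together; two
  consecutive prefixes differ by the sale of rank \<open>j\<close>.\<close>

lemma owned_fills_net_eq_increment:
  assumes "executes_in_order M \<pi> x \<omega>" "j < num_pos M"
  shows "(\<Sum>f \<in> owned_fills M (\<pi> j) \<omega>. fill_net M f \<omega>) = increment M \<pi> x j \<omega>"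
proof -
  let ?F = "\<lambda>k. \<Sum>f \<in> owned_fills M (\<pi> k) \<omega>. fill_net M f \<omega>"
  have *: "\<forall>j \<le> num_pos M. (\<Sum>k<j. ?F k) = book M (cum_qty \<pi> x j) \<omega>"
    using assms(1) by (simp add: executes_in_order_def)
  have "(\<Sum>k<Suc j. ?F k) = book M (cum_qty \<pi> x (Suc j)) \<omega>"
    "(\<Sum>k<j. ?F k) = book M (cum_qty \<pi> x j) \<omega>"
    using * assms(2) by (simp_all only: Suc_leI less_imp_le)
  then show ?thesis
    by (simp add: increment_eq_diff)
qed

lemma executes_in_order_no_double_assignment:
  assumes "book_wf M" "executes_in_order M \<pi> x \<omega>"
  shows "no_double_assignment M \<pi> x \<omega>"
proof -
  define n where "n = num_pos M"
  define lo where "lo = (\<lambda>j. book M (cum_qty \<pi> x j) \<omega>)"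
  have fold_lo: "book M (cum_qty \<pi> x j) \<omega> = lo j" for j
    by (simp add: lo_def)
  have lo0: "lo 0 = 0"
    using assms(1) by (simp add: lo_def cum_qty_def book_wf_def)
  have inc: "increment M \<pi> x j \<omega> = lo (Suc j) - lo j" for j
    by (simp add: increment_eq_diff lo_def)
  have total: "book M (\<Sum>j<n. x (\<pi> j)) \<omega> = lo n"
    by (simp add: lo_def cum_qty_def)
  have sum_inc: "(\<Sum>j<n. increment M \<pi> x j \<omega>) = lo n"
    using sum_lessThan_telescope[of lo n] by (simp add: inc lo0)
  \<comment> \<open>By \<open>unit_count_eq\<close> each summand is a difference of indicators of
    two down-closed rays, so the sum telescopes whatever the order of the endpoints.\<close>
  have units: "(\<Sum>j<n. unit_count (lo j) (lo (Suc j)) y) = unit_count 0 (lo n) y" for y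
    using sum_lessThan_telescope[of "\<lambda>j. of_bool (y \<le> lo j) :: int" n]
    by (simp add: unit_count_eq lo0)
  have disj: "{lo j<..lo (Suc j)} \<inter> {lo k<..lo (Suc k)} = {}"
    if nonneg: "\<forall>j<n. 0 \<le> increment M \<pi> x j \<omega>" and jk: "j < n" "k < n" "j \<noteq> k" for j k
  proof -
    \<comment> \<open>Nonnegative increments make cumulative proceeds monotone up to
      \<open>n\<close>. For \<open>a < b\<close> the interval of \<open>a\<close> then ends no later
      than that of \<open>b\<close> starts, and half-openness excludes a shared endpoint.\<close>
    have mono: "lo a \<le> lo b" if "a \<le> b" "b \<le> n" for a b
      using that(1,2)
    proof (induction b rule: dec_induct)
      case (step b)
      then have "lo b \<le> lo (Suc b)"
        using nonneg by (simp add: inc)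
      with step show ?case by simp
    qed simp
    have "{lo a<..lo (Suc a)} \<inter> {lo b<..lo (Suc b)} = {}" if "a < b" "b < n" for a b
      using mono[of "Suc a" b] that by auto
    with jk show ?thesis
      by (metis Int_commute linorder_neqE_nat)
  qed
  show ?thesis
    \<comment> \<open>\<open>cum_qty_Suc\<close> read backwards turns the upper end of a rank into
      the lower end of the next one.\<close>
    unfolding no_double_assignment_def Let_def cum_qty_Suc[symmetric]
    using owned_fills_net_eq_increment[OF assms(2)] sum_inc units disj
    by (simp only: n_def[symmetric] total fold_lo) blast
qed

text \<open>The infimum is at most its value on the operating path \<open>\<omega>\<close>. Chaining
  in \<open>ereal\<close> avoids showing that the infimum is finite: only the two ends must be
  real.\<close>

lemma feasible_covers_service_bound:
  assumes "priority_feasible M \<pi> x" "\<omega> \<in> op_set M" "j < num_pos M"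
  shows "service_bound M (\<pi> j) + buffer M (\<pi> j) \<le> own_cash M (\<pi> j) + increment M \<pi> x j \<omega>"
proof -
  have "ereal (service_bound M (\<pi> j) + buffer M (\<pi> j))
      \<le> ereal (own_cash M (\<pi> j)) + lower_proceeds M \<pi> x j"
    using assms by (simp add: priority_feasible_def)
  also have "\<dots> \<le> ereal (own_cash M (\<pi> j)) + ereal (increment M \<pi> x j \<omega>)"
    unfolding lower_proceeds_def by (intro add_left_mono INF_lower assms(2))
  finally show ?thesis by simp
qed

text \<open>Fills are grouped by confirmation time; instants of \<open>A\<close> without a
  confirmation contribute empty sums.\<close>

lemma sum_receipts:
  assumes "finite (fills M \<omega>)" "finite A" "\<forall>f \<in> owned_fills M i \<omega>. confirm_time M f \<omega> \<in> A"
  shows "(\<Sum>t\<in>A. receipt M i t \<omega>) = (\<Sum>f \<in> owned_fills M i \<omega>. fill_net M f \<omega>)"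
proof -
  have "finite (owned_fills M i \<omega>)"
    using assms(1) by (simp add: owned_fills_def)
  then show ?thesis
    unfolding receipt_def using assms(2,3) by (intro sum.group) auto
qed

section \<open>Ledger of a single position around its last settlement\<close>

locale settled_position =
  fixes M :: "('w, 'f) shared_book" and i :: nat and \<omega> :: 'w
  assumes wf: "book_wf M" and i: "i < num_pos M"
    and escape: "collateral_non_escape M \<omega>"
    and finality: "settlement_finality M \<omega>"
    and rule: "debt_first M \<omega>"
    and no_borrow: "no_new_borrowing M \<omega>"
begin

abbreviation "L \<equiv> ledger_times M i \<omega>"
abbreviation "S \<equiv> settle_times M i \<omega>"
abbreviation "T \<equiv> Max S"

lemma finite_L: "finite L" and L_window: "L \<subseteq> {dec_time M <.. end_time M}" and S_L: "S \<subseteq> L"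
  and paid_nonneg: "0 \<le> paid M i t \<omega>"
  and removed_nonneg: "0 \<le> removed M a i t \<omega>"
  and removed_allowed: "removed M a i t \<omega> \<noteq> 0 \<Longrightarrow> can_remove M a i t \<omega>"
  and debt_nonneg: "t \<in> {dec_time M .. end_time M} \<Longrightarrow> 0 \<le> debt M i t \<omega>"
  and accrued_mono: "mono_on {dec_time M .. end_time M} (\<lambda>t. accrued M i t \<omega>)"
  and finite_fills: "finite (fills M \<omega>)"
  using wf i by (simp_all add: book_wf_def)

lemma accrued_const:
  assumes "dec_time M \<le> s" "s \<le> t" "t \<le> end_time M" "debt M i s \<omega> = 0"
    "\<forall>r \<in> {s <.. t}. drawn M i r \<omega> = 0"
  shows "accrued M i t \<omega> = accrued M i s \<omega>"
proof -
  have "\<forall>s t. dec_time M \<le> s \<and> s \<le> t \<and> t \<le> end_time M \<and> debt M i s \<omega> = 0 \<and>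
      (\<forall>r \<in> {s <.. t}. drawn M i r \<omega> = 0) \<longrightarrow> accrued M i t \<omega> = accrued M i s \<omega>"
    using wf i unfolding book_wf_def by blast
  with assms show ?thesis by blast
qed

lemma finite_S: "finite S" using finite_L S_L by (rule rev_finite_subset)

lemma S_nonempty: "S \<noteq> {}" using rule i by (simp add: debt_first_def)

lemma T_in_S: "T \<in> S" by (simp add: finite_S S_nonempty)

lemma T_window: "dec_time M < T" "T \<le> end_time M"
  using T_in_S S_L L_window by auto

lemma drawn_zero: "t \<in> {dec_time M <.. end_time M} \<Longrightarrow> drawn M i t \<omega> = 0"
  using no_borrow i by (simp add: no_new_borrowing_def)

lemma paid_zero:
  assumes "t \<in> L" "t \<notin> S" shows "paid M i t \<omega> = 0"
proof (rule ccontr)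
  assume "paid M i t \<omega> \<noteq> 0"
  then have "0 < paid M i t \<omega>" using paid_nonneg[of t] by simp
  moreover have "t \<in> {dec_time M .. end_time M}" using assms(1) L_window by auto
  ultimately show False using finality i assms(2) by (auto simp: settlement_finality_def)
qed

lemma debt_eq: "debt M i t \<omega> = debt_at_dec M i + accrued M i t \<omega> - (\<Sum>s \<in> {s \<in> L. s \<le> t}. paid M i s \<omega>)"
proof -
  have "(\<Sum>s \<in> {s \<in> L. s \<le> t}. drawn M i s \<omega> - paid M i s \<omega>) = (\<Sum>s \<in> {s \<in> L. s \<le> t}. - paid M i s \<omega>)"
    using drawn_zero L_window by (intro sum.cong) auto
  then show ?thesis by (simp add: debt_def sum_negf)
qed

text \<open>Zero debt stops accrual while nothing is drawn, and cumulative payments only grow, so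
  debt cannot rise; nonnegativity pins it at zero.\<close>

lemma cleared_stays_cleared:
  assumes "dec_time M \<le> s" "s \<le> t" "t \<le> end_time M" "debt M i s \<omega> = 0"
  shows "debt M i t \<omega> = 0"
proof -
  have "accrued M i t \<omega> = accrued M i s \<omega>"
    using assms drawn_zero by (intro accrued_const) auto
  moreover have "(\<Sum>r \<in> {r \<in> L. r \<le> s}. paid M i r \<omega>) \<le> (\<Sum>r \<in> {r \<in> L. r \<le> t}. paid M i r \<omega>)"
    using assms(2) finite_L by (intro sum_mono2) (auto simp: paid_nonneg)
  ultimately have "debt M i t \<omega> \<le> debt M i s \<omega>" by (simp add: debt_eq)
  with debt_nonneg[of t] assms show ?thesis by simp
qed

lemma total_paid_eq: "total_paid M i \<omega> = (\<Sum>s \<in> {s \<in> L. s \<le> T}. paid M i s \<omega>)"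
  unfolding total_paid_def
proof (rule sum.mono_neutral_right)
  show "\<forall>s \<in> L - {s \<in> L. s \<le> T}. paid M i s \<omega> = 0"
    using paid_zero Max_ge[OF finite_S] by auto
qed (use finite_L in auto)

text \<open>Beyond \<open>T\<close> payments vanish and only accrual moves the debt, upwards. This
  carries a zero terminal debt back to \<open>T\<close>.\<close>

lemma debt_last_settlement_le_end: "debt M i T \<omega> \<le> debt M i (end_time M) \<omega>"
proof -
  have "{s \<in> L. s \<le> end_time M} = L" using L_window by auto
  then have "(\<Sum>s \<in> {s \<in> L. s \<le> end_time M}. paid M i s \<omega>) = (\<Sum>s \<in> {s \<in> L. s \<le> T}. paid M i s \<omega>)"
    using total_paid_eq by (simp add: total_paid_def)
  moreover have "accrued M i T \<omega> \<le> accrued M i (end_time M) \<omega>"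
    using T_window by (intro mono_onD[OF accrued_mono]) auto
  ultimately show ?thesis by (simp add: debt_eq)
qed

text \<open>Isolates the instant \<open>T\<close>, because the sums in \<open>debt_before\<close>
  and \<open>cash_before\<close> cover strictly earlier instants only.\<close>

lemma sum_upto_last_settlement:
  "(\<Sum>s \<in> {s \<in> L. s \<le> T}. g s) = (\<Sum>s \<in> {s \<in> L. s < T}. g s) + g T" for g :: "real \<Rightarrow> real"
proof -
  have "{s \<in> L. s \<le> T} = insert T {s \<in> L. s < T}" using T_in_S S_L by auto
  then show ?thesis using finite_L by simp
qed

lemma last_payment: "paid M i T \<omega> = min (debt_before M i T \<omega>) (cash_before M i T \<omega> + receipt M i T \<omega>)"
  using rule i T_in_S by (simp add: debt_first_def)

lemma debt_last_settlement: "debt M i T \<omega> = debt_before M i T \<omega> - paid M i T \<omega>"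
  using drawn_zero[of T] T_window
  by (simp add: debt_def debt_before_def sum_upto_last_settlement)

text \<open>Cash conservation: every fill of the position is confirmed at a settlement time, hence
  by \<open>T\<close>, so no proceeds are missing from the balance.\<close>

lemma cash_before_last_settlement:
  "cash_before M i T \<omega> + receipt M i T \<omega> + (\<Sum>s \<in> {s \<in> L. s < T}. paid M i s \<omega>)
    = own_cash M i + (\<Sum>f \<in> owned_fills M i \<omega>. fill_net M f \<omega>)
        - (\<Sum>s \<in> {s \<in> L. s < T}. removed M Dedicated_Cash i s \<omega>)"
proof -
  have "\<forall>f \<in> owned_fills M i \<omega>. confirm_time M f \<omega> \<in> {s \<in> L. s \<le> T}"
    using rule i S_L Max_ge[OF finite_S] by (auto simp: debt_first_def)
  then have "(\<Sum>s \<in> {s \<in> L. s \<le> T}. receipt M i s \<omega>) = (\<Sum>f \<in> owned_fills M i \<omega>. fill_net M f \<omega>)"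
    using finite_fills finite_L by (intro sum_receipts) auto
  then show ?thesis
    by (simp add: cash_before_def sum_subtractf sum_upto_last_settlement)
qed

text \<open>The payment at \<open>T\<close> is capped by the available cash, which removals can only
  lower.\<close>

lemma total_paid_le:
  "total_paid M i \<omega> \<le> own_cash M i + (\<Sum>f \<in> owned_fills M i \<omega>. fill_net M f \<omega>)"
proof -
  have "0 \<le> (\<Sum>s \<in> {s \<in> L. s < T}. removed M Dedicated_Cash i s \<omega>)"
    by (intro sum_nonneg removed_nonneg)
  then show ?thesis
    using last_payment cash_before_last_settlement
    by (simp add: total_paid_eq sum_upto_last_settlement)
qed

lemma debt_last_settlement_zero:
  assumes "service_requirement M i \<omega> \<le> own_cash M i + (\<Sum>f \<in> owned_fills M i \<omega>. fill_net M f \<omega>)"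
  shows "debt M i T \<omega> = 0"
proof (rule ccontr)
  assume uncleared: "debt M i T \<omega> \<noteq> 0"
  \<comment> \<open>A removal requires zero debt at its instant, and zero debt would persist until
    \<open>T\<close>.\<close>
  have "removed M a i s \<omega> = 0" if "s \<in> L" "s < T" for a s
  proof (rule ccontr)
    assume "removed M a i s \<omega> \<noteq> 0"
    then have "can_remove M a i s \<omega>" by (rule removed_allowed)
    moreover have s: "s \<in> {dec_time M .. end_time M}" using that(1) L_window by auto
    ultimately have "\<not> 0 < debt M i s \<omega>"
      using escape i by (auto simp: collateral_non_escape_def)
    then have "debt M i s \<omega> = 0" using debt_nonneg[OF s] by simp
    then show False
      using cleared_stays_cleared[of s T] uncleared that s T_window by auto
  qed
  then have "(\<Sum>s \<in> {s \<in> L. s < T}. removed M Dedicated_Cash i s \<omega>) = 0" by simp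
  \<comment> \<open>Since debt survives \<open>T\<close>, the minimum in the debt-first rule is not
    the debt, so it is the available cash.\<close>
  moreover have "paid M i T \<omega> = cash_before M i T \<omega> + receipt M i T \<omega>"
    using last_payment debt_last_settlement uncleared by (simp add: min_def split: if_splits)
  ultimately have "total_paid M i \<omega>
      = own_cash M i + (\<Sum>f \<in> owned_fills M i \<omega>. fill_net M f \<omega>)"
    using cash_before_last_settlement by (simp add: total_paid_eq sum_upto_last_settlement)
  \<comment> \<open>Payments alone already exhaust the bound on payments plus terminal debt.\<close>
  then have "debt M i (end_time M) \<omega> \<le> 0"
    using assms by (simp add: service_requirement_def)
  then show False
    using debt_last_settlement_le_end debt_nonneg[of T] T_window uncleared by simp
qed

end

theorem theorem8p4:
  fixes M :: "('w, 'f) shared_book"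
    and \<pi> :: "nat \<Rightarrow> nat" and x :: "nat \<Rightarrow> real" and \<omega> :: 'w
  assumes "book_wf M"
    and "service_bound_valid M"
    and "priority_feasible M \<pi> x"
    and "\<omega> \<in> op_set M"
    and "market_close M \<omega> > ereal (dec_time M + horizon M)"
    and "execution_authority M \<omega>"
    and "collateral_non_escape M \<omega>" and "loan_priority M \<omega>"
    and "settlement_finality M \<omega>"
    and "executes_in_order M \<pi> x \<omega>"
    and "debt_first M \<omega>"
    and "fills_settle_in_window M \<omega>"
    and "no_new_borrowing M \<omega>"
  shows "clears_in_order M \<pi> x \<omega> \<and> no_double_assignment M \<pi> x \<omega>"
proof
  show "no_double_assignment M \<pi> x \<omega>"
    using assms(1,10) by (rule executes_in_order_no_double_assignment)
  have pos: "settled_position M (\<pi> j) \<omega>" and rank: "\<pi> j < num_pos M" if "j < num_pos M" for j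
  proof -
    show "\<pi> j < num_pos M"
      using assms(3) that by (auto simp: priority_feasible_def bij_betw_def)
    then show "settled_position M (\<pi> j) \<omega>"
      using assms by unfold_locales
  qed
  have cleared: "debt M (\<pi> j) t \<omega> = 0"
    if j: "j < num_pos M" and t: "Max (settle_times M (\<pi> j) \<omega>) \<le> t" "t \<le> end_time M" for j t
  proof -
    interpret settled_position M "\<pi> j" \<omega> by (rule pos[OF j])
    have "service_requirement M (\<pi> j) \<omega> \<le> service_bound M (\<pi> j)" "0 \<le> buffer M (\<pi> j)"
      using assms(1,2,4) rank[OF j] by (simp_all add: service_bound_valid_def book_wf_def)
    \<comment> \<open>Feasibility covers bound plus buffer, hence, the buffer being nonnegative, the
      realized requirement.\<close>
    then have "service_requirement M (\<pi> j) \<omega> \<le> own_cash M (\<pi> j) + increment M \<pi> x j \<omega>"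
      using feasible_covers_service_bound[OF assms(3,4) j] by simp
    then have "debt M (\<pi> j) T \<omega> = 0"
      by (intro debt_last_settlement_zero) (simp add: owned_fills_net_eq_increment[OF assms(10) j])
    then show ?thesis
      using t T_window by (intro cleared_stays_cleared[of T t]) auto
  qed
  have stage: "stage_end M \<pi> j \<omega> \<le> end_time M"
    "k \<le> j \<Longrightarrow> Max (settle_times M (\<pi> k) \<omega>) \<le> stage_end M \<pi> j \<omega>" if j: "j < num_pos M" for j k
  proof -
    let ?U = "\<Union>k\<le>j. settle_times M (\<pi> k) \<omega>"
    \<comment> \<open>\<open>Max\<close> is only meaningful on finite nonempty sets; each rank up to
      \<open>j\<close> supplies both properties.\<close>
    have S: "finite (settle_times M (\<pi> k) \<omega>)" "settle_times M (\<pi> k) \<omega> \<noteq> {}"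
      "settle_times M (\<pi> k) \<omega> \<subseteq> {.. end_time M}" if "k \<le> j" for k
    proof -
      interpret settled_position M "\<pi> k" \<omega> using pos that j by simp
      show "finite S" "S \<noteq> {}" "S \<subseteq> {.. end_time M}"
        using finite_S S_nonempty S_L L_window by auto
    qed
    have U: "finite ?U" using S(1) by simp
    show "stage_end M \<pi> j \<omega> \<le> end_time M"
      unfolding stage_end_def using U S(2,3) by (subst Max_le_iff) auto
    show "Max (settle_times M (\<pi> k) \<omega>) \<le> stage_end M \<pi> j \<omega>" if "k \<le> j"
      unfolding stage_end_def using U S(2)[OF that] that by (intro Max_mono) auto
  qed
  show "clears_in_order M \<pi> x \<omega>"
    unfolding clears_in_order_def
  proof (intro allI impI conjI ballI)
    fix j assume j: "j < num_pos M"
    interpret settled_position M "\<pi> j" \<omega> by (rule pos[OF j])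
    show "debt M (\<pi> j) (end_time M) \<omega> = 0"
      using cleared[OF j] T_window by simp
    show "debt M (\<pi> j) t \<omega> = 0" if "t \<in> {T .. end_time M}" for t
      using cleared[OF j] that by simp
    show "stage_end M \<pi> j \<omega> \<le> end_time M"
      by (rule stage(1)[OF j])
    \<comment> \<open>The last settlement of rank \<open>k\<close> is no later than the end of stage
      \<open>j\<close>, so \<open>cleared\<close> applies at rank \<open>k\<close>.\<close>
    show "debt M (\<pi> k) t \<omega> = 0" if "k \<le> j" "t \<in> {stage_end M \<pi> j \<omega> .. end_time M}" for k t
      using cleared[of k t] stage(2)[OF j that(1)] that j by simp
    show "total_paid M (\<pi> j) \<omega> \<le> own_cash M (\<pi> j) + increment M \<pi> x j \<omega>"
      using total_paid_le by (simp add: owned_fills_net_eq_increment[OF assms(10) j])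
  qed
qed

end
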